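(* Let $A,B\in\mathbb{Q}$ with $AB\neq0$, and suppose that $x^4+Ax+B$ has the rational non-zero root $v$. Then reducibility over $\mathbb{Q}$ of $(x^8+Ax^2+B)/(x^2-v)$ implies that this polynomial has reducibility type $(3,3)$, and this occurs precisely when, up to scaling, $$A=-\frac{(q^2+2q-1)(9q^2-10q+3)}{4},\qquad B=\frac{(q-1)^2(2q-1)(3q-1)^2}{4}$$ for some $q\in\mathbb{Q}$ with $q\neq1,\tfrac12,\tfrac13$.
   Context: A monic polynomial in $\mathbb{Q}[x]$ has reducibility type $(n_1,\dots,n_k)$, $n_1\le\dots\le n_k$, if it factors as a product of $k$ irreducible polynomials in $\mathbb{Q}[x]$ of degrees $n_1,\dots,n_k$. Trinomials are considered up to scaling: $x^8+Ax^2+B$ may be replaced by $x^8+A\lambda^6x^2+B\lambda^8$ with $\lambda\in\mathbb{Q}\setminus\{0\}$ (and correspondingly $v$ by $\lambda^2v$).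
   Formalization: That reducibility implies type (3,3) is stated only when v is the sole rational root of x^4+Ax+B, and a simple one; it fails otherwise, e.g. A=-15, B=14, v=1. The equivalence of type (3,3) with the parametrization is stated for every rational non-zero root v. *)

theory Defs
  imports "HOL-Computational_Algebra.Computational_Algebra"
begin

text \<open>The trinomial \<open>x^n + A x^m + B\<close>.\<close>

definition trinomial :: "nat \<Rightarrow> nat \<Rightarrow> rat \<Rightarrow> rat \<Rightarrow> rat poly" where
  "trinomial n m A B = monom 1 n + monom A m + [:B:]"

text \<open>Degrees are listed in non-decreasing order and with repetition.\<close>

definition has_reducibility_type :: "rat poly \<Rightarrow> nat list \<Rightarrow> bool" where
  "has_reducibility_type p ns \<longleftrightarrow>
     lead_coeff p = 1 \<and> sorted ns \<and>
     (\<exists>fs. map degree fs = ns \<and> (\<forall>f\<in>set fs. irreducible f) \<and> p = prod_list fs)"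

text \<open>Scaling for trinomials of the shape \<open>x^8 + A x^2 + B\<close>:
  \<open>A\<close> has weight \<open>8 - 2 = 6\<close> and \<open>B\<close> has weight \<open>8\<close>.\<close>

definition equal_up_to_scaling :: "rat \<times> rat \<Rightarrow> rat \<times> rat \<Rightarrow> bool" where
  "equal_up_to_scaling P P' \<longleftrightarrow>
     (\<exists>l. l \<noteq> 0 \<and> fst P = fst P' * l ^ 6 \<and> snd P = snd P' * l ^ 8)"

end

theory Submission
  imports Defs
begin

text \<open>
  Write \<open>w = v^3 + A\<close>, so that \<open>Q(x) = g(x^2)\<close> with \<open>g(y) = y^3 + v y^2 + v^2 y + w\<close>.
  If \<open>f\<close> is an irreducible proper factor of \<open>Q\<close>, then so is \<open>f(-x)\<close>, and \<open>f(x) f(-x)\<close> is a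
  polynomial in \<open>x^2\<close>; irreducibility of \<open>g\<close>, or the type \<open>(3, 3)\<close>, then forces \<open>Q = - f(x) f(-x)\<close> for a monic cubic
  \<open>f = x^3 + a x^2 + b x + e\<close>. Comparing coefficients gives \<open>v = 2 b - a^2\<close> and
  \<open>v^2 = b^2 - 2 a e\<close>, and \<open>q = b / a^2\<close> is the parameter.

  Conversely, a type \<open>(3, 3)\<close> requires that \<open>f\<close> has no rational root for any admissible \<open>q\<close>. For a
  fixed root, \<open>f\<close> is quadratic in \<open>q\<close>, and its discriminant yields a rational point on
  \<open>y^2 = x (x^2 - 2 x + 9)\<close>. Doubling a point of this curve and applying a 2-isogeny gives a rational
  number \<open>b\<close> such that \<open>b^2 - 4\<close> and \<open>b^2 + 8\<close> are squares, which Fermat descent excludes.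
  Finally, if the trinomial has a rational root other than the one supplied by the parameter, then
  \<open>f\<close> has a rational root as well, so this case does not occur.
\<close>

subsection \<open>Descent for \<open>b\<^sup>2 - a\<^sup>2\<close> and \<open>b\<^sup>2 + 2 a\<^sup>2\<close>\<close>

lemma coprime_mult_eq_powerE:
  fixes x y z :: nat
  assumes "coprime x y" "x * y = z ^ n" "n > 0"
  obtains p q where "x = p ^ n" "y = q ^ n" "p * q = z"
proof -
  have "is_nth_power n (x * y)"
    using assms(2) by (auto simp: is_nth_power_def)
  then obtain p q where "x = p ^ n" "y = q ^ n"
    using is_nth_power_mult_coprime_nat_iff[OF assms(1)] by (auto simp: is_nth_power_def)
  moreover have "p * q = z"
  proof (rule power_eq_imp_eq_base)
    show "(p * q) ^ n = z ^ n"
      using assms(2) calculation by (simp add: power_mult_distrib)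
  qed (use assms(3) in auto)
  ultimately show ?thesis using that by blast
qed

lemma coprime_mult_eq_power_intE:
  fixes x y :: int and z :: nat
  assumes "coprime x y" "x * y = int z ^ n" "n > 0" "x > 0"
  obtains p q :: nat where "x = int p ^ n" "y = int q ^ n" "p * q = z"
proof -
  have "0 \<le> x * y"
    using assms(2) by simp
  then have "y \<ge> 0"
    using assms(4) by (simp add: zero_le_mult_iff)
  define x' y' where "x' = nat x" and "y' = nat y"
  have xy: "x = int x'" "y = int y'"
    using assms(4) \<open>y \<ge> 0\<close> by (simp_all add: x'_def y'_def)
  have "coprime x' y'"
    using assms(1) xy by simp
  moreover have "x' * y' = z ^ n"
    using assms(2) xy by (simp flip: of_nat_mult of_nat_power)
  ultimately obtain p q where "x' = p ^ n" "y' = q ^ n" "p * q = z"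
    using coprime_mult_eq_powerE assms(3) by blast
  with that xy show ?thesis by simp
qed

lemma power2_mod_3: "z\<^sup>2 mod 3 = (if 3 dvd z then 0 else 1)" for z :: int
proof -
  have "z mod 3 = 0 \<or> z mod 3 = 1 \<or> z mod 3 = 2" by presburger
  moreover have "z\<^sup>2 mod 3 = (z mod 3)\<^sup>2 mod 3" by (simp add: power_mod)
  ultimately show ?thesis
    unfolding dvd_eq_mod_eq_0 by (elim disjE) simp_all
qed

lemma three_dvd_if_sum_squares:
  fixes x y :: int
  assumes "3 dvd x\<^sup>2 + y\<^sup>2"
  shows "3 dvd x" "3 dvd y"
proof -
  have "(x\<^sup>2 mod 3 + y\<^sup>2 mod 3) mod 3 = 0"
    using assms by (simp add: mod_add_eq dvd_eq_mod_eq_0)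
  then show "3 dvd x" "3 dvd y" by (simp_all add: power2_mod_3 split: if_splits)
qed

lemma power2_mod_4: "n\<^sup>2 mod 4 = (if even n then 0 else 1)" for n :: nat
proof -
  have "n mod 4 = 0 \<or> n mod 4 = 1 \<or> n mod 4 = 2 \<or> n mod 4 = 3" by presburger
  moreover have "even n \<longleftrightarrow> even (n mod 4)" by presburger
  moreover have "n\<^sup>2 mod 4 = (n mod 4)\<^sup>2 mod 4" by (simp add: power_mod)
  ultimately show ?thesis
    by (elim disjE) simp_all
qed

text \<open>As \<open>u\<close> is even, it absorbs the factor 2, and 3 divides \<open>u\<close> or
  \<open>w\<close>. Once both are removed, coprime cofactors with product \<open>l ^ 4\<close>
  remain, so each is a fourth power. The pair is thus \<open>6 \<beta>^4, \<alpha>^4\<close> or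
  \<open>2 \<alpha>^4, 3 \<beta>^4\<close>.\<close>

lemma coprime_even_mult_eq_six_fourth_powerE:
  fixes u w l :: nat
  assumes uw: "coprime u w" "u * w = 6 * l ^ 4" and "even u"
  obtains \<alpha> \<beta> where "\<alpha> * \<beta> = l" "coprime \<alpha> \<beta>"
    "u + w = \<alpha> ^ 4 + 6 * \<beta> ^ 4 \<or> u + w = 2 * \<alpha> ^ 4 + 3 * \<beta> ^ 4"
proof -
  obtain u' where u': "u = 2 * u'" using assms(3) by blast
  have "u' * w = 3 * l ^ 4" using uw(2) u' by simp
  then have "3 dvd u' * w" by simp
  then have "3 dvd u' \<or> 3 dvd w" by (simp add: prime_dvd_mult_iff)
  then show thesis
  proof
    assume "3 dvd u'"
    then obtain u'' where u'': "u' = 3 * u''" by blast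
    have cop: "coprime u'' w" and eq: "u'' * w = l ^ 4" using uw u' u'' by auto
    obtain p q where pq: "u'' = p ^ 4" "w = q ^ 4" "p * q = l"
      using coprime_mult_eq_powerE[OF cop eq] by auto
    show thesis
    proof (rule that)
      show "coprime q p" using cop pq by (simp add: coprime_commute)
    qed (use pq u' u'' in auto)
  next
    assume "3 dvd w"
    then obtain w' where w': "w = 3 * w'" by blast
    have cop: "coprime u' w'" and eq: "u' * w' = l ^ 4" using uw u' w' by auto
    obtain p q where pq: "u' = p ^ 4" "w' = q ^ 4" "p * q = l"
      using coprime_mult_eq_powerE[OF cop eq] by auto
    show thesis
    proof (rule that)
      show "coprime p q" using cop pq by simp
    qed (use pq u' w' in auto)
  qed
qed

lemma coprime_mult_eq_six_fourth_powerE: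
  fixes u w l :: nat
  assumes "coprime u w" "u * w = 6 * l ^ 4"
  obtains \<alpha> \<beta> where "\<alpha> * \<beta> = l" "coprime \<alpha> \<beta>"
    "u + w = \<alpha> ^ 4 + 6 * \<beta> ^ 4 \<or> u + w = 2 * \<alpha> ^ 4 + 3 * \<beta> ^ 4"
proof -
  have "even (u * w)" using assms(2) by simp
  then consider "even u" | "even w" by auto
  then show thesis
  proof cases
    case 1 then show ?thesis
      using coprime_even_mult_eq_six_fourth_powerE[OF assms] that by blast
  next
    case 2
    have "coprime w u" "w * u = 6 * l ^ 4"
      using assms by (simp_all add: coprime_commute mult.commute)
    from coprime_even_mult_eq_six_fourth_powerE[OF this 2] that show ?thesis
      by (metis add.commute)
  qed
qed

lemma coprime_if_no_common_prime:
  fixes a b :: nat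
  assumes "\<And>p. prime p \<Longrightarrow> p dvd a \<Longrightarrow> p dvd b \<Longrightarrow> False"
  shows "coprime a b"
proof (rule ccontr)
  assume "\<not> coprime a b"
  then have "gcd a b \<noteq> 1" by (simp add: coprime_iff_gcd_eq_1)
  then obtain p where "prime p" "p dvd gcd a b" using prime_factor_nat by blast
  then show False using assms by auto
qed

text \<open>Modulo 3 the equation forces 3 to divide \<open>x\<close> and \<open>z\<close>. Hence 9
  divides \<open>3 * y^2\<close>, so 3 divides \<open>y\<close> as well.\<close>

lemma three_squares_sum_not_coprime:
  fixes x y z :: int
  assumes "coprime x y" "3 * y\<^sup>2 = x\<^sup>2 + z\<^sup>2"
  shows False
proof -
  have "3 dvd x\<^sup>2 + z\<^sup>2" using assms(2) by (metis dvd_triv_left)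
  from three_dvd_if_sum_squares[OF this] obtain x' z' where xz: "x = 3 * x'" "z = 3 * z'" by blast
  have "y\<^sup>2 = 3 * (x'\<^sup>2 + z'\<^sup>2)" using assms(2) xz by (simp add: power2_eq_square algebra_simps)
  then have "3 dvd y\<^sup>2" by simp
  then have "3 dvd y" by (simp add: prime_dvd_power_iff)
  moreover have "3 dvd x" using xz by simp
  ultimately have "3 dvd (1::int)" using assms(1) by (meson coprime_common_divisor)
  then show False by simp
qed

text \<open>The square of a common prime divides \<open>6 * l ^ 4\<close>. As 6 is squarefree, the
  prime divides \<open>l\<close>, and the sum \<open>u + w\<close> then passes it on to
  \<open>k\<close>.\<close>

lemma coprime_factors_of_six_fourth_power:
  fixes u w k l :: nat
  assumes cop: "coprime k l" and uw: "u * w = 6 * l ^ 4" "u + w = k\<^sup>2 + 5 * l\<^sup>2"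
  shows "coprime u w"
proof (rule coprime_if_no_common_prime)
  fix p assume p: "prime p" "p dvd u" "p dvd w"
  have "p dvd l"
  proof (rule ccontr)
    assume "\<not> p dvd l"
    then have "coprime (p\<^sup>2) (l ^ 4)" using p(1) by (simp add: prime_imp_coprime)
    moreover have "p\<^sup>2 dvd 6 * l ^ 4" 
      unfolding power2_eq_square using mult_dvd_mono[OF p(2,3)] uw(1) by simp
    ultimately have dvd6: "p\<^sup>2 dvd 6" by (simp add: coprime_dvd_mult_left_iff)
    then have "p\<^sup>2 \<le> 6" by (simp add: dvd_imp_le)
    then have "p\<^sup>2 < 3\<^sup>2" by simp
    then have "p < 3" by (rule power_less_imp_less_base) simp
    then have "p = 2" using prime_ge_2_nat[OF p(1)] by simp
    then show False using dvd6 by simp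
  qed
  then have "p dvd 5 * l\<^sup>2" by (simp add: power2_eq_square)
  moreover have "p dvd k\<^sup>2 + 5 * l\<^sup>2" using p(2,3) uw(2) by (metis dvd_add)
  ultimately have "p dvd k\<^sup>2" by (simp add: dvd_add_left_iff)
  then have "p dvd k" using p(1) prime_dvd_power by blast
  with \<open>p dvd l\<close> cop p(1) show False
    by (metis coprime_common_divisor_nat not_prime_1)
qed

text \<open>The equation says
  \<open>k^2 = (\<alpha>^2 - 2 \<beta>^2) (\<alpha>^2 - 3 \<beta>^2)\<close>. The factors are
  coprime, so they are squares up to a common sign, and divisibility by 3 rules out the negative
  sign. This yields a new solution of the equations under descent, with \<open>\<beta>\<close> in
  the role of \<open>a\<close>.\<close>

lemma concordant_descent_odd_split:
  fixes \<alpha> \<beta> k :: nat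
  assumes cop: "coprime \<alpha> \<beta>" and "k > 0"
    and eq: "k\<^sup>2 + 5 * (\<alpha> * \<beta>)\<^sup>2 = \<alpha> ^ 4 + 6 * \<beta> ^ 4"
  obtains S T where "coprime \<beta> S" "S\<^sup>2 = \<beta>\<^sup>2 + T\<^sup>2" "\<alpha>\<^sup>2 = S\<^sup>2 + 2 * \<beta>\<^sup>2"
proof -
  define x y where "x = int \<alpha>" and "y = int \<beta>"
  have copxy: "coprime x y" using cop by (simp add: x_def y_def)
  define X Y where "X = x\<^sup>2 - 2 * y\<^sup>2" and "Y = x\<^sup>2 - 3 * y\<^sup>2"
  have XY: "X * Y = (int k)\<^sup>2"
  proof -
    have "int (k\<^sup>2 + 5 * (\<alpha> * \<beta>)\<^sup>2) = int (\<alpha> ^ 4 + 6 * \<beta> ^ 4)" using eq by simp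
    then show ?thesis unfolding X_def Y_def x_def y_def
      by (simp add: power2_eq_square power4_eq_xxxx algebra_simps)
  qed
  have copXY: "coprime X Y"
  proof (rule coprimeI)
    fix d assume d: "d dvd X" "d dvd Y"
    have "y\<^sup>2 = X - Y" "x\<^sup>2 = 3 * X - 2 * Y" by (simp_all add: X_def Y_def)
    then have "d dvd y\<^sup>2" "d dvd x\<^sup>2" using d by (simp_all add: dvd_diff)
    moreover have "coprime (x\<^sup>2) (y\<^sup>2)" using copxy by simp
    ultimately show "is_unit d" using coprime_common_divisor by blast
  qed
  have "X \<noteq> 0" using XY \<open>k > 0\<close> by auto
  have "\<not> X < 0"
  proof
    assume "X < 0"
    then have pos: "- X > 0" by simp
    have "coprime (- X) (- Y)" "(- X) * (- Y) = (int k)\<^sup>2" using copXY XY by simp_all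
    from coprime_mult_eq_power_intE[OF this pos2 pos] obtain S T
      where "- X = (int S)\<^sup>2" "- Y = (int T)\<^sup>2" by blast
    then have "3 * y\<^sup>2 = x\<^sup>2 + (int T)\<^sup>2" by (simp add: Y_def)
    with copxy show False by (rule three_squares_sum_not_coprime)
  qed
  then have "X > 0" using \<open>X \<noteq> 0\<close> by simp
  from coprime_mult_eq_power_intE[OF copXY XY pos2 this] obtain S T
    where ST: "X = (int S)\<^sup>2" "Y = (int T)\<^sup>2" by blast
  have e1: "S\<^sup>2 = \<beta>\<^sup>2 + T\<^sup>2"
  proof -
    have "int (S\<^sup>2) = int (\<beta>\<^sup>2 + T\<^sup>2)" using ST by (simp add: X_def Y_def y_def)
    then show ?thesis by (simp only: of_nat_eq_iff)
  qed
  have e2: "\<alpha>\<^sup>2 = S\<^sup>2 + 2 * \<beta>\<^sup>2"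
  proof -
    have "int (\<alpha>\<^sup>2) = int (S\<^sup>2 + 2 * \<beta>\<^sup>2)" using ST by (simp add: X_def x_def y_def)
    then show ?thesis by (simp only: of_nat_eq_iff)
  qed
  have "coprime \<beta> S"
  proof (rule coprime_if_no_common_prime)
    fix p assume p: "prime p" "p dvd \<beta>" "p dvd S"
    then have "p dvd \<alpha>\<^sup>2" unfolding e2 by (simp add: power2_eq_square)
    then have "p dvd \<alpha>" using p(1) prime_dvd_power by blast
    with p cop show False by (metis coprime_common_divisor_nat not_prime_1)
  qed
  with e1 e2 that show ?thesis by blast
qed

text \<open>Here \<open>k^2 = (\<beta>^2 - \<alpha>^2) (3 \<beta>^2 - 2 \<alpha>^2)\<close>, treated
  in the same way. In the new solution \<open>S\<close> plays the role of \<open>a\<close>, and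
  \<open>S * T = k\<close> bounds it.\<close>

lemma concordant_descent_even_split:
  fixes \<alpha> \<beta> k :: nat
  assumes cop: "coprime \<alpha> \<beta>" and "k > 0"
    and eq: "k\<^sup>2 + 5 * (\<alpha> * \<beta>)\<^sup>2 = 2 * \<alpha> ^ 4 + 3 * \<beta> ^ 4"
  obtains S T where "coprime S \<beta>" "\<beta>\<^sup>2 = S\<^sup>2 + \<alpha>\<^sup>2" "T\<^sup>2 = \<beta>\<^sup>2 + 2 * S\<^sup>2" "S * T = k"
proof -
  define x y where "x = int \<alpha>" and "y = int \<beta>"
  have copxy: "coprime x y" using cop by (simp add: x_def y_def)
  define X Y where "X = y\<^sup>2 - x\<^sup>2" and "Y = 3 * y\<^sup>2 - 2 * x\<^sup>2"
  have XY: "X * Y = (int k)\<^sup>2"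
  proof -
    have "int (k\<^sup>2 + 5 * (\<alpha> * \<beta>)\<^sup>2) = int (2 * \<alpha> ^ 4 + 3 * \<beta> ^ 4)" using eq by simp
    then show ?thesis unfolding X_def Y_def x_def y_def
      by (simp add: power2_eq_square power4_eq_xxxx algebra_simps)
  qed
  have copXY: "coprime X Y"
  proof (rule coprimeI)
    fix d assume d: "d dvd X" "d dvd Y"
    have "y\<^sup>2 = Y - 2 * X" "x\<^sup>2 = Y - 3 * X" by (simp_all add: X_def Y_def)
    then have "d dvd y\<^sup>2" "d dvd x\<^sup>2" using d by (simp_all add: dvd_diff)
    moreover have "coprime (x\<^sup>2) (y\<^sup>2)" using copxy by simp
    ultimately show "is_unit d" using coprime_common_divisor by blast
  qed
  have "X \<noteq> 0" using XY \<open>k > 0\<close> by auto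
  have "\<not> X < 0"
  proof
    assume "X < 0"
    then have pos: "- X > 0" by simp
    have "coprime (- X) (- Y)" "(- X) * (- Y) = (int k)\<^sup>2" using copXY XY by simp_all
    from coprime_mult_eq_power_intE[OF this pos2 pos] obtain S T
      where ST: "- X = (int S)\<^sup>2" "- Y = (int T)\<^sup>2" by blast
    then have "3 * (int S)\<^sup>2 = x\<^sup>2 + (int T)\<^sup>2" by (simp add: X_def Y_def)
    moreover have "coprime x (int S)"
    proof (rule coprimeI)
      fix d assume d: "d dvd x" "d dvd int S"
      have "y\<^sup>2 = x * x - int S * int S" using ST(1) by (simp add: X_def power2_eq_square)
      then have "d dvd y\<^sup>2" using d by simp
      moreover have "d dvd x\<^sup>2" using d by (simp add: power2_eq_square)
      moreover have "coprime (x\<^sup>2) (y\<^sup>2)" using copxy by simp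
      ultimately show "is_unit d" using coprime_common_divisor by blast
    qed
    ultimately show False using three_squares_sum_not_coprime by blast
  qed
  then have "X > 0" using \<open>X \<noteq> 0\<close> by simp
  from coprime_mult_eq_power_intE[OF copXY XY pos2 this] obtain S T
    where ST: "X = (int S)\<^sup>2" "Y = (int T)\<^sup>2" "S * T = k" by blast
  have e1: "\<beta>\<^sup>2 = S\<^sup>2 + \<alpha>\<^sup>2"
  proof -
    have "int (\<beta>\<^sup>2) = int (S\<^sup>2 + \<alpha>\<^sup>2)" using ST by (simp add: X_def x_def y_def)
    then show ?thesis by (simp only: of_nat_eq_iff)
  qed
  have e2: "T\<^sup>2 = \<beta>\<^sup>2 + 2 * S\<^sup>2"
  proof -
    have "int (T\<^sup>2) = int (\<beta>\<^sup>2 + 2 * S\<^sup>2)" using ST(1) ST(2)[symmetric] by (simp add: X_def Y_def y_def)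
    then show ?thesis by (simp only: of_nat_eq_iff)
  qed
  have "coprime S \<beta>"
  proof (rule coprime_if_no_common_prime)
    fix p assume p: "prime p" "p dvd S" "p dvd \<beta>"
    have "p dvd \<beta>\<^sup>2" "p dvd S\<^sup>2" using p by (simp_all add: power2_eq_square)
    then have "p dvd \<alpha>\<^sup>2" unfolding e1 by (simp add: dvd_add_right_iff)
    then have "p dvd \<alpha>" using p(1) prime_dvd_power by blast
    with p cop show False by (metis coprime_common_divisor_nat not_prime_1)
  qed
  with e1 e2 ST(3) that show ?thesis by blast
qed

lemma add_double_mod_4: "(m + 2 * n) mod 4 = (m mod 4 + 2 * (n mod 4)) mod 4" for m n :: nat
  by (subst mod_add_left_eq, subst (1 2) mod_add_right_eq[symmetric], subst mod_mult_right_eq, rule refl)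

text \<open>Fermat descent on \<open>a\<close>. Parametrizing the Pythagorean triple by
  \<open>k\<close> and \<open>l\<close> turns the second equation into
  \<open>t^2 = (k^2 + 5 l^2)^2 - 24 l^4\<close>. Factoring this difference of squares leads to a
  solution whose first entry is positive and at most \<open>l\<close> or \<open>k\<close>, both
  below \<open>a = 2 k l\<close>.\<close>

lemma coprime_concordant_squares_trivial:
  fixes a b s t :: nat
  assumes "coprime a b" "b\<^sup>2 = a\<^sup>2 + s\<^sup>2" "t\<^sup>2 = b\<^sup>2 + 2 * a\<^sup>2"
  shows "a = 0"
  using assms
proof (induction a arbitrary: b s t rule: less_induct)
  case (less a)
  show ?case
  proof (rule ccontr)
    assume "a \<noteq> 0"
    \<comment> \<open>If \<open>a\<close> were odd, \<open>t^2\<close> would be 2 or 3 modulo 4,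
      which no square is. So \<open>a\<close> is even, and \<open>b\<close>, \<open>s\<close> and
      \<open>t\<close> are odd.\<close>
    have mod4: "t\<^sup>2 mod 4 = (b\<^sup>2 mod 4 + 2 * (a\<^sup>2 mod 4)) mod 4"
      unfolding less.prems(3) by (rule add_double_mod_4)
    have "\<not> (even a \<and> even b)"
      using coprime_common_divisor_nat[OF less.prems(1), of 2] by auto
    moreover have "even a"
    proof (rule ccontr)
      assume "odd a"
      then show False using mod4 by (cases "even t"; cases "even b") (simp_all add: power2_mod_4)
    qed
    ultimately have "odd b" by simp
    have "odd (a\<^sup>2 + s\<^sup>2)" using less.prems(2) \<open>odd b\<close> by (metis even_power)
    then have "odd s" using \<open>even a\<close> by simp
    have "odd (t\<^sup>2)" unfolding less.prems(3) using \<open>odd b\<close> by simp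
    then have "odd t" by auto
    obtain a' where a': "a = 2 * a'" using \<open>even a\<close> by blast
    have "s\<^sup>2 \<le> b\<^sup>2" using less.prems(2) by simp
    then have "s \<le> b" by (rule power2_le_imp_le) simp
    moreover have "even (b - s)" using \<open>odd b\<close> \<open>odd s\<close> by simp
    ultimately obtain U where U: "b = s + 2 * U" by (metis dvdE le_add_diff_inverse)
    have UW: "U * (s + U) = a'\<^sup>2"
      using less.prems(2) unfolding U a' by (simp add: power2_eq_square algebra_simps)
    have "coprime U (s + U)"
    proof (rule coprime_if_no_common_prime)
      fix p assume p: "prime p" "p dvd U" "p dvd s + U"
      have "p dvd U + (s + U)" using p by (metis dvd_add)
      also have "U + (s + U) = b" unfolding U by simp
      finally have "p dvd b" .
      have "p dvd a'\<^sup>2" using p(2) UW by (metis dvd_mult2)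
      then have "p dvd a'" using p(1) prime_dvd_power by blast
      then have "p dvd a" using a' by simp
      with \<open>p dvd b\<close> p(1) less.prems(1) show False
        by (metis coprime_common_divisor_nat not_prime_1)
    qed
    \<comment> \<open>The Pythagorean triple is \<open>(2 k l, k\<^sup>2 - l\<^sup>2, k\<^sup>2 + l\<^sup>2)\<close>.\<close>
    from coprime_mult_eq_powerE[OF this UW] obtain l k
      where lk: "U = l\<^sup>2" "s + U = k\<^sup>2" "l * k = a'" by auto
    have "coprime k l"
      using \<open>coprime U (s + U)\<close> lk by (simp add: coprime_commute)
    have b: "b = k\<^sup>2 + l\<^sup>2" using U lk by simp
    have a: "a = 2 * (l * k)" using a' lk by simp
    have "k > 0" "l > 0" using a \<open>a \<noteq> 0\<close> by auto
    have t: "t\<^sup>2 + 24 * l ^ 4 = (k\<^sup>2 + 5 * l\<^sup>2)\<^sup>2"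
      unfolding less.prems(3) a b by (simp add: power2_eq_square power4_eq_xxxx algebra_simps)
    then have "t\<^sup>2 \<le> (k\<^sup>2 + 5 * l\<^sup>2)\<^sup>2" by linarith
    then have "t \<le> k\<^sup>2 + 5 * l\<^sup>2" by (rule power2_le_imp_le) simp
    moreover have "even (k\<^sup>2 + 5 * l\<^sup>2 - t)" using \<open>odd b\<close> \<open>odd t\<close> b by simp
    \<comment> \<open>With \<open>k^2 + 5 l^2 = t + 2 u\<close>, the difference of squares is
      \<open>4 u (t + u)\<close>, so that \<open>u\<close> and \<open>t + u\<close> have product
      \<open>6 l^4\<close>.\<close>
    ultimately obtain u where u: "k\<^sup>2 + 5 * l\<^sup>2 = t + 2 * u" by (metis dvdE le_add_diff_inverse)
    have uw: "u * (t + u) = 6 * l ^ 4"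
      using t unfolding u by (simp add: power2_eq_square algebra_simps)
    have sum: "u + (t + u) = k\<^sup>2 + 5 * l\<^sup>2" using u by simp
    have "coprime u (t + u)"
      using coprime_factors_of_six_fourth_power[OF \<open>coprime k l\<close> uw sum] .
    from coprime_mult_eq_six_fourth_powerE[OF this uw] obtain \<alpha> \<beta>
      where \<alpha>\<beta>: "\<alpha> * \<beta> = l" "coprime \<alpha> \<beta>" and
        cases: "k\<^sup>2 + 5 * (\<alpha> * \<beta>)\<^sup>2 = \<alpha> ^ 4 + 6 * \<beta> ^ 4 \<or> k\<^sup>2 + 5 * (\<alpha> * \<beta>)\<^sup>2 = 2 * \<alpha> ^ 4 + 3 * \<beta> ^ 4"
      unfolding sum by metis
    have pos: "\<alpha> > 0" "\<beta> > 0" using \<alpha>\<beta>(1) \<open>l > 0\<close> by auto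
    have "l < a" "k < a" using a \<open>k > 0\<close> \<open>l > 0\<close> by simp_all
    from cases show False
    proof
      assume "k\<^sup>2 + 5 * (\<alpha> * \<beta>)\<^sup>2 = \<alpha> ^ 4 + 6 * \<beta> ^ 4"
      from concordant_descent_odd_split[OF \<alpha>\<beta>(2) \<open>k > 0\<close> this] obtain S T
        where "coprime \<beta> S" "S\<^sup>2 = \<beta>\<^sup>2 + T\<^sup>2" "\<alpha>\<^sup>2 = S\<^sup>2 + 2 * \<beta>\<^sup>2" .
      note less.IH[OF _ this]
      moreover have "\<beta> \<le> l" using \<alpha>\<beta>(1) pos by auto
      then have "\<beta> < a" using \<open>l < a\<close> by simp
      ultimately show False using pos by simp
    next
      assume "k\<^sup>2 + 5 * (\<alpha> * \<beta>)\<^sup>2 = 2 * \<alpha> ^ 4 + 3 * \<beta> ^ 4"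
      from concordant_descent_even_split[OF \<alpha>\<beta>(2) \<open>k > 0\<close> this] obtain S T
        where ST: "coprime S \<beta>" "\<beta>\<^sup>2 = S\<^sup>2 + \<alpha>\<^sup>2" "T\<^sup>2 = \<beta>\<^sup>2 + 2 * S\<^sup>2" "S * T = k" .
      then have "S > 0" "S \<le> k" using \<open>k > 0\<close> by auto
      with \<open>k < a\<close> have "S < a" by simp
      from less.IH[OF this ST(1-3)] \<open>S > 0\<close> show False by simp
    qed
  qed
qed

section \<open>From coprime natural numbers to rational numbers\<close>

lemma rat_abs_clear_denom:
  fixes x :: rat
  obtains d k :: nat where "d > 0" "of_nat k = of_nat d * \<bar>x\<bar>"
proof -
  obtain m n where mn: "x = of_int m / of_int n" "n > 0"
    by (cases x rule: Rat_cases) (auto simp: Fract_of_int_quotient)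
  show ?thesis
  proof (rule that)
    show "nat n > 0" using mn by simp
    show "of_nat (nat \<bar>m\<bar>) = of_nat (nat n) * \<bar>x\<bar>"
      using mn by (simp add: abs_divide)
  qed
qed

text \<open>The equations are homogeneous, so the gcd \<open>g\<close> of \<open>a\<close> and
  \<open>b\<close> can be divided out: \<open>g^2\<close> divides \<open>s^2\<close> and
  \<open>t^2\<close>, hence \<open>g\<close> divides \<open>s\<close> and \<open>t\<close>.\<close>

lemma concordant_squares_trivial_nat:
  fixes a b s t :: nat
  assumes "b\<^sup>2 = a\<^sup>2 + s\<^sup>2" "t\<^sup>2 = b\<^sup>2 + 2 * a\<^sup>2"
  shows "a = 0"
proof (rule ccontr)
  assume "a \<noteq> 0"
  define g where "g = gcd a b"
  have "g > 0" using \<open>a \<noteq> 0\<close> by (simp add: g_def)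
  obtain a' b' where ab: "a = a' * g" "b = b' * g" "coprime a' b'"
    using gcd_coprime_exists[of a b] \<open>g > 0\<close> unfolding g_def by auto
  have eq: "b'\<^sup>2 * g\<^sup>2 = a'\<^sup>2 * g\<^sup>2 + s\<^sup>2" "t\<^sup>2 = (b'\<^sup>2 + 2 * a'\<^sup>2) * g\<^sup>2"
    using assms ab by (simp_all add: power_mult_distrib algebra_simps)
  have "s\<^sup>2 = (b'\<^sup>2 - a'\<^sup>2) * g\<^sup>2" using eq(1) by (simp add: diff_mult_distrib)
  then have "g\<^sup>2 dvd s\<^sup>2" "g\<^sup>2 dvd t\<^sup>2" using eq(2) by simp_all
  then obtain s' t' where st: "s = s' * g" "t = t' * g"
    by (metis dvdE mult.commute pow_divides_pow_iff pos2)
  have "b'\<^sup>2 * g\<^sup>2 = (a'\<^sup>2 + s'\<^sup>2) * g\<^sup>2" "t'\<^sup>2 * g\<^sup>2 = (b'\<^sup>2 + 2 * a'\<^sup>2) * g\<^sup>2"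
    using eq st by (simp_all add: power_mult_distrib algebra_simps)
  then have "b'\<^sup>2 = a'\<^sup>2 + s'\<^sup>2" "t'\<^sup>2 = b'\<^sup>2 + 2 * a'\<^sup>2"
    using \<open>g > 0\<close> by simp_all
  then have "a' = 0" using coprime_concordant_squares_trivial ab(3) by blast
  then show False using ab(1) \<open>a \<noteq> 0\<close> by simp
qed

text \<open>Only squares occur, so absolute values may be taken, and homogeneity allows
  multiplication by the common denominator \<open>D\<close>.\<close>

lemma concordant_squares_trivial:
  fixes a b s t :: rat
  assumes "b\<^sup>2 = a\<^sup>2 + s\<^sup>2" "t\<^sup>2 = b\<^sup>2 + 2 * a\<^sup>2"
  shows "a = 0"
proof -
  obtain da a' :: nat where a: "da > 0" "of_nat a' = of_nat da * \<bar>a\<bar>" by (rule rat_abs_clear_denom)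
  obtain db b' :: nat where b: "db > 0" "of_nat b' = of_nat db * \<bar>b\<bar>" by (rule rat_abs_clear_denom)
  obtain ds s' :: nat where s: "ds > 0" "of_nat s' = of_nat ds * \<bar>s\<bar>" by (rule rat_abs_clear_denom)
  obtain dt t' :: nat where t: "dt > 0" "of_nat t' = of_nat dt * \<bar>t\<bar>" by (rule rat_abs_clear_denom)
  define D where "D = da * db * ds * dt"
  define a0 b0 s0 t0 where "a0 = a' * db * ds * dt" and "b0 = b' * da * ds * dt"
    and "s0 = s' * da * db * dt" and "t0 = t' * da * db * ds"
  have scaled: "(of_nat a0 :: rat) = of_nat D * \<bar>a\<bar>" "(of_nat b0 :: rat) = of_nat D * \<bar>b\<bar>"
    "(of_nat s0 :: rat) = of_nat D * \<bar>s\<bar>" "(of_nat t0 :: rat) = of_nat D * \<bar>t\<bar>"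
    unfolding a0_def b0_def s0_def t0_def D_def by (simp_all add: a b s t)
  have "(of_nat (b0\<^sup>2) :: rat) = of_nat (a0\<^sup>2 + s0\<^sup>2)"
    using assms(1) by (simp add: scaled power_mult_distrib distrib_left)
  moreover have "(of_nat (t0\<^sup>2) :: rat) = of_nat (b0\<^sup>2 + 2 * a0\<^sup>2)"
    using assms(2) by (simp add: scaled power_mult_distrib algebra_simps)
  ultimately have "b0\<^sup>2 = a0\<^sup>2 + s0\<^sup>2" "t0\<^sup>2 = b0\<^sup>2 + 2 * a0\<^sup>2"
    by (simp_all only: of_nat_eq_iff)
  then have "a0 = 0" by (rule concordant_squares_trivial_nat)
  then show ?thesis using scaled(1) a b s t by (simp add: D_def)
qed

subsection \<open>The elliptic curve\<close>

text \<open>Positivity of the quadratic factor gives \<open>x > 0\<close> away from the origin.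
  Points with \<open>x = 3\<close> double to the 2-torsion point \<open>(0, 0)\<close>. For any
  other point \<open>z\<close> below is non-zero, and \<open>(w / z)^2 - 4\<close> and
  \<open>(w / z)^2 + 8\<close> are squares, which the descent forbids.\<close>

lemma elliptic_curve_rational_points:
  fixes x y :: rat
  assumes "y\<^sup>2 = x * (x\<^sup>2 - 2 * x + 9)"
  shows "x = 0 \<or> x = 3"
proof (rule ccontr)
  assume contra: "\<not> (x = 0 \<or> x = 3)"
  have quad: "x\<^sup>2 - 2 * x + 9 > 0"
  proof -
    have "x\<^sup>2 - 2 * x + 9 = (x - 1)\<^sup>2 + 8" by (simp add: power2_eq_square algebra_simps)
    then show ?thesis by (metis add_nonneg_pos zero_le_power2 zero_less_numeral)
  qed
  have "x * (x\<^sup>2 - 2 * x + 9) \<ge> 0" using assms by (metis zero_le_power2)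
  then have "x > 0" using quad contra by (simp add: zero_le_mult_iff)
  then have "y\<^sup>2 \<noteq> 0" using assms quad by simp
  then have "y \<noteq> 0" by simp
  \<comment> \<open>\<open>z\<^sup>2\<close> is the abscissa of the double of \<open>(x, y)\<close>, and \<open>z * w\<close> is up to sign its ordinate.\<close>
  define z where "z = (x\<^sup>2 - 9) / (2 * y)"
  have "x\<^sup>2 - 9 = (x - 3) * (x + 3)" by (simp add: power2_eq_square algebra_simps)
  then have "x\<^sup>2 - 9 \<noteq> 0" using contra \<open>x > 0\<close> by simp
  then have "z \<noteq> 0" using \<open>y \<noteq> 0\<close> by (simp add: z_def)
  define w where "w = (x ^ 4 - 4 * x ^ 3 + 54 * x\<^sup>2 - 36 * x + 81) / (4 * y\<^sup>2)"
  have w: "w\<^sup>2 = z ^ 4 - 2 * z\<^sup>2 + 9"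
  proof -
    have z2: "z\<^sup>2 = (x\<^sup>2 - 9)\<^sup>2 / (4 * y\<^sup>2)" by (simp add: z_def power_divide power_mult_distrib)
    define V where "V = y\<^sup>2"
    have "V \<noteq> 0" using \<open>y\<^sup>2 \<noteq> 0\<close> by (simp add: V_def)
    \<comment> \<open>This states \<open>w^2 = z^4 - 2 z^2 + 9\<close> with denominators cleared. It
      becomes an identity in \<open>x\<close> once the curve equation eliminates
      \<open>y^2\<close>.\<close>
    have poly: "(x ^ 4 - 4 * x ^ 3 + 54 * x\<^sup>2 - 36 * x + 81)\<^sup>2
        = (x\<^sup>2 - 9) ^ 4 - 2 * (x\<^sup>2 - 9)\<^sup>2 * (4 * V) + 9 * (4 * V)\<^sup>2"
      unfolding V_def assms by algebra
    have "z ^ 4 - 2 * z\<^sup>2 + 9 = (z\<^sup>2)\<^sup>2 - 2 * z\<^sup>2 + 9" by simp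
    also have "\<dots> = ((x\<^sup>2 - 9) ^ 4 - 2 * (x\<^sup>2 - 9)\<^sup>2 * (4 * V) + 9 * (4 * V)\<^sup>2) / (4 * V)\<^sup>2"
      unfolding z2 V_def[symmetric] using \<open>V \<noteq> 0\<close>
      by (simp add: field_simps power2_eq_square power4_eq_xxxx)
    also have "\<dots> = w\<^sup>2"
      unfolding poly[symmetric] w_def V_def[symmetric] by (simp add: power_divide)
    finally show ?thesis ..
  qed
  \<comment> \<open>The square is completed in \<open>z^4 - 2 z^2 + 9\<close> in two ways. Division
    by \<open>z^2\<close> then gives the pair of equations of the descent with
    \<open>a = 2\<close>.\<close>
  have "w\<^sup>2 = 2\<^sup>2 * z\<^sup>2 + (z\<^sup>2 - 3)\<^sup>2" "(z\<^sup>2 + 3)\<^sup>2 = w\<^sup>2 + 2 * 2\<^sup>2 * z\<^sup>2"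
    unfolding w by algebra+
  moreover have "z\<^sup>2 \<noteq> 0" using \<open>z \<noteq> 0\<close> by simp
  note cancel = add_divide_distrib nonzero_mult_div_cancel_right[OF this]
  ultimately have "w\<^sup>2 / z\<^sup>2 = 2\<^sup>2 + (z\<^sup>2 - 3)\<^sup>2 / z\<^sup>2"
    "(z\<^sup>2 + 3)\<^sup>2 / z\<^sup>2 = w\<^sup>2 / z\<^sup>2 + 2 * 2\<^sup>2"
    by (metis cancel)+
  then have "(w / z)\<^sup>2 = 2\<^sup>2 + ((z\<^sup>2 - 3) / z)\<^sup>2" "((z\<^sup>2 + 3) / z)\<^sup>2 = (w / z)\<^sup>2 + 2 * 2\<^sup>2"
    by (simp_all only: power_divide)
  then have "(2::rat) = 0" by (rule concordant_squares_trivial)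
  then show False by simp
qed

text \<open>A root makes \<open>6 x + 3\<close> the abscissa of a rational point on the elliptic
  curve. The abscissas 0 and 3 mean \<open>x = -1/2\<close> and \<open>x = 0\<close>, where the
  equation reduces to \<open>(2 q - 1)^2 = 0\<close> and \<open>(3 q - 1) (q - 1) = 0\<close>:
  exactly the excluded parameters.\<close>

lemma normalized_cubic_no_root:
  fixes q x :: rat
  assumes "q \<noteq> 1" "q \<noteq> 1 / 2" "q \<noteq> 1 / 3"
  shows "x ^ 3 + x\<^sup>2 + q * x - (3 * q - 1) * (q - 1) / 2 \<noteq> 0"
proof
  assume eq: "x ^ 3 + x\<^sup>2 + q * x - (3 * q - 1) * (q - 1) / 2 = 0"
  \<comment> \<open>The square below is 36 times a quarter of the discriminant of the equation, read as a quadratic in \<open>q\<close>.\<close>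
  define X where "X = 6 * x + 3"
  have "(6 * (3 * q - 2 - x))\<^sup>2 = X * (X\<^sup>2 - 2 * X + 9)"
    unfolding X_def using eq by algebra
  then have "X = 0 \<or> X = 3" by (rule elliptic_curve_rational_points)
  then show False
  proof
    assume "X = 0"
    then have x: "x = - 1 / 2" by (simp add: X_def)
    have "(2 * q - 1)\<^sup>2 = 0" using eq unfolding x by algebra
    then show False using assms(2) by simp
  next
    assume "X = 3"
    then have x: "x = 0" by (simp add: X_def)
    then show False using eq assms by auto
  qed
qed

subsection \<open>Factors of even polynomials\<close>

lemma degree_1_has_root:
  fixes p :: "'a :: field poly"
  assumes "degree p = 1"
  obtains x where "poly p x = 0"
proof
  have "coeff p 1 \<noteq> 0" using assms by (metis leading_coeff_0_iff degree_0 zero_neq_one)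
  then show "poly p (- coeff p 0 / coeff p 1) = 0"
    using assms by (simp add: poly_altdef)
qed

lemma irreducible_cubic_if_no_root:
  fixes p :: "'a :: field poly"
  assumes "degree p = 3" "\<And>x. poly p x \<noteq> 0"
  shows "irreducible p"
proof (rule irreducibleI)
  show "p \<noteq> 0" using assms(1) by auto
  then show "\<not> p dvd 1" using assms(1) by (simp add: is_unit_iff_degree)
  fix a b assume p: "p = a * b"
  with \<open>p \<noteq> 0\<close> have "a \<noteq> 0" "b \<noteq> 0" by auto
  then have "degree a + degree b = 3" using assms(1) p by (simp add: degree_mult_eq)
  moreover have "degree a \<noteq> 1"
    using assms(2) p degree_1_has_root[of a] by (metis mult_zero_left poly_mult)
  moreover have "degree b \<noteq> 1"
    using assms(2) p degree_1_has_root[of b] by (metis mult_zero_right poly_mult)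
  ultimately have "degree a = 0 \<or> degree b = 0" by arith
  then show "a dvd 1 \<or> b dvd 1" using \<open>a \<noteq> 0\<close> \<open>b \<noteq> 0\<close> by (simp add: is_unit_iff_degree)
qed

text \<open>Composition with a non-constant \<open>s\<close> is an injective ring homomorphism that
  multiplies degrees by \<open>degree s\<close>. It therefore preserves division with remainder, and
  a non-zero remainder would stay too small in degree to be divisible.\<close>

lemma pcompose_dvd_cancel:
  fixes r g s :: "'a :: field poly"
  assumes "pcompose r s dvd pcompose g s" "degree s > 0"
  shows "r dvd g"
proof (cases "r = 0")
  case True
  then have "pcompose g s = 0" using assms(1) by simp
  then show ?thesis using assms(2) True pcompose_eq_0 by fastforce
next
  case False
  have "pcompose g s = pcompose (g div r) s * pcompose r s + pcompose (g mod r) s"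
    by (simp flip: pcompose_mult pcompose_add)
  then have dvd: "pcompose r s dvd pcompose (g mod r) s"
    using assms(1) by (simp add: dvd_add_right_iff)
  have "g mod r = 0"
  proof (rule ccontr)
    assume nz: "g mod r \<noteq> 0"
    then have "pcompose (g mod r) s \<noteq> 0" using assms(2) pcompose_eq_0 by blast
    then have "degree (pcompose r s) \<le> degree (pcompose (g mod r) s)"
      using dvd dvd_imp_degree_le by blast
    then have "degree r \<le> degree (g mod r)" using assms(2) by (simp add: degree_pcompose)
    then show False using degree_mod_less'[OF False nz] by simp
  qed
  then show ?thesis by (simp add: dvd_eq_mod_eq_0)
qed

section \<open>The involution \<open>x -> -x\<close> and factors of even polynomials\<close>

definition reflect :: "'a :: comm_ring_1 poly \<Rightarrow> 'a poly" where
  "reflect p = pcompose p [:0, -1:]"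

lemma reflect_reflect [simp]: "reflect (reflect p) = p"
  by (simp add: reflect_def pcompose_assoc[symmetric] pcompose_pCons)

lemma reflect_0 [simp]: "reflect 0 = 0"
  by (simp add: reflect_def)

lemma reflect_mult: "reflect (p * q) = reflect p * reflect q"
  by (simp add: reflect_def pcompose_mult)

lemma degree_reflect [simp]: "degree (reflect p) = degree p" for p :: "'a :: idom poly"
  by (simp add: reflect_def degree_pcompose)

lemma reflect_even [simp]: "reflect (pcompose p [:0, 0, 1:]) = pcompose p [:0, 0, 1:]"
  by (simp add: reflect_def pcompose_assoc[symmetric] pcompose_pCons)

lemma coeff_reflect: "coeff (reflect p) n = (- 1) ^ n * coeff p n"
  by (simp add: reflect_def coeff_pcompose_linear)

lemma reflect_eq_0_iff [simp]: "reflect p = 0 \<longleftrightarrow> p = 0"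
  by (metis reflect_reflect reflect_0)

lemma is_unit_reflect: "is_unit (reflect p) \<longleftrightarrow> is_unit p" for p :: "'a :: field poly"
  by (cases "p = 0") (auto simp: is_unit_iff_degree reflect_eq_0_iff)

lemma irreducible_reflect:
  fixes p :: "'a :: field poly"
  assumes "irreducible p"
  shows "irreducible (reflect p)"
proof (rule irreducibleI)
  show "reflect p \<noteq> 0" using assms by auto
  show "\<not> is_unit (reflect p)" using assms by (simp add: is_unit_reflect irreducible_not_unit)
  fix a b assume "reflect p = a * b"
  then have "p = reflect a * reflect b" by (metis reflect_mult reflect_reflect)
  then have "is_unit (reflect a) \<or> is_unit (reflect b)" by (rule irreducibleD[OF assms])
  then show "is_unit a \<or> is_unit b" by (simp only: is_unit_reflect)
qed

text \<open>Induction works because prepending a coefficient multiplies by \<open>x\<close>, which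
  exchanges the even and the odd part.\<close>

lemma even_odd_decomposition:
  fixes p :: "'a :: comm_ring_1 poly"
  obtains e d where "p = pcompose e [:0, 0, 1:] + [:0, 1:] * pcompose d [:0, 0, 1:]"
proof (induction p arbitrary: thesis rule: pCons_induct)
  case 0
  show ?case by (rule 0[of 0 0]) simp
next
  case (pCons a p)
  obtain e d where p: "p = pcompose e [:0, 0, 1:] + [:0, 1:] * pcompose d [:0, 0, 1:]"
    by (rule pCons.IH)
  show ?case
  proof (rule pCons.prems)
    have "pCons a p = [:a:] + [:0, 1:] * p" by simp
    also have "\<dots> = pcompose (pCons a d) [:0, 0, 1:] + [:0, 1:] * pcompose e [:0, 0, 1:]"
      unfolding p by (simp add: pcompose_pCons algebra_simps)
    finally show "pCons a p = pcompose (pCons a d) [:0, 0, 1:] + [:0, 1:] * pcompose e [:0, 0, 1:]" .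
  qed
qed

lemma dvd_same_degreeE:
  fixes p q :: "'a :: field poly"
  assumes "p dvd q" "degree p = degree q" "q \<noteq> 0"
  obtains c where "c \<noteq> 0" "q = smult c p"
proof -
  obtain h where h: "q = p * h" using assms(1) by blast
  with assms(3) have "p \<noteq> 0" "h \<noteq> 0" by auto
  then have "degree h = 0" using h assms(2) by (simp add: degree_mult_eq)
  then obtain c where "h = [:c:]" by (rule degree_eq_zeroE)
  with h \<open>h \<noteq> 0\<close> show ?thesis by (intro that[of c]) auto
qed

text \<open>Reflection preserves the degree, so the quotient is a scalar. Comparing the non-zero
  constant coefficients shows that it is 1.\<close>

lemma dvd_reflect_imp_even:
  fixes f :: "'a :: field poly"
  assumes "f dvd reflect f" "coeff f 0 \<noteq> 0"
  shows "reflect f = f"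
proof -
  have "coeff (reflect f) 0 \<noteq> 0" using assms(2) by (simp add: coeff_reflect)
  then have "reflect f \<noteq> 0" by auto
  then obtain c where c: "reflect f = smult c f"
    using dvd_same_degreeE[OF assms(1)] by auto
  have "coeff f 0 = c * coeff f 0"
    using arg_cong[OF c, of "\<lambda>p. coeff p 0"] by (simp add: coeff_reflect)
  then show ?thesis using c assms(2) by simp
qed

text \<open>Reflecting \<open>Q = f * h\<close> shows that the prime \<open>f\<close> divides
  \<open>reflect f * reflect h\<close>, hence \<open>reflect h\<close>.\<close>

lemma even_polynomial_factor_reflect:
  fixes f Q :: "'a :: field poly"
  assumes "irreducible f" "\<not> f dvd reflect f" "f dvd Q" "reflect Q = Q"
  obtains m where "Q = f * reflect f * m"
proof -
  obtain h where h: "Q = f * h" using assms(3) by blast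
  have "prime_elem f" using assms(1) by (rule field_poly_irreducible_imp_prime)
  moreover have "f dvd reflect f * reflect h"
    using assms(3,4) h by (metis reflect_mult)
  ultimately have "f dvd reflect h" using assms(2) by (simp add: prime_elem_dvd_mult_iff)
  then obtain m where "reflect h = f * m" by blast
  then have "h = reflect f * reflect m" by (metis reflect_mult reflect_reflect)
  with h that[of "reflect m"] show ?thesis by (simp add: mult.assoc)
qed

lemma irreducible_factor_exists:
  fixes p :: "'a :: field poly"
  assumes "degree p > 0"
  obtains f where "f dvd p" "irreducible f"
  using assms
proof (induction "degree p" arbitrary: p thesis rule: less_induct)
  case less
  show ?case
  proof (cases "irreducible p")
    case True
    then show ?thesis by (intro less.prems(1)[of p]) simp_all
  next
    case False
    have "p \<noteq> 0" using less.prems(2) by auto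
    then have "\<not> is_unit p" using less.prems(2) by (simp add: is_unit_iff_degree)
    with False \<open>p \<noteq> 0\<close> obtain a b where ab: "p = a * b" "\<not> is_unit a" "\<not> is_unit b"
      by (auto simp: irreducible_def)
    with \<open>p \<noteq> 0\<close> have "a \<noteq> 0" "b \<noteq> 0" by auto
    with ab have deg: "degree a > 0" "degree b > 0" "degree p = degree a + degree b"
      by (simp_all add: is_unit_iff_degree degree_mult_eq)
    then obtain f where "f dvd a" "irreducible f" using less.hyps[of a] by auto
    then show ?thesis using less.prems(1)[of f] ab(1) by simp
  qed
qed

text \<open>Let \<open>f\<close> be an irreducible proper factor. If \<open>f\<close> were even, it
  would come from a proper factor of \<open>g\<close>. Otherwise \<open>f * reflect f\<close>
  divides the polynomial and comes from a non-constant divisor \<open>P\<close> of \<open>g\<close>,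
  whose degree must be that of \<open>g\<close>; so only a scalar is left over.\<close>

lemma reducible_even_polynomial_factorization:
  fixes g :: "'a :: field_char_0 poly"
  assumes g: "irreducible g" "poly g 0 \<noteq> 0"
    and red: "\<not> irreducible (pcompose g [:0, 0, 1:])"
  obtains f c where "irreducible f" "degree f = degree g"
    "pcompose g [:0, 0, 1:] = smult c (f * reflect f)"
proof -
  define Q where "Q = pcompose g [:0, 0, 1:]"
  have "degree g > 0"
    using g(1) by (metis gr0I irreducible_not_unit is_unit_iff_degree not_irreducible_zero)
  then have degQ: "degree Q = 2 * degree g" "degree Q > 0" by (simp_all add: Q_def degree_pcompose)
  then have "Q \<noteq> 0" by auto
  have "\<not> is_unit Q" using degQ \<open>Q \<noteq> 0\<close> by (simp add: is_unit_iff_degree)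
  with red \<open>Q \<noteq> 0\<close> obtain a b where ab: "Q = a * b" "\<not> is_unit a" "\<not> is_unit b"
    unfolding Q_def[symmetric] by (auto simp: irreducible_def)
  have nz: "a \<noteq> 0" "b \<noteq> 0" using ab \<open>Q \<noteq> 0\<close> by auto
  have "degree a > 0" using ab(2) nz(1) by (simp add: is_unit_iff_degree)
  then obtain f where f: "f dvd a" and irr: "irreducible f"
    by (rule irreducible_factor_exists)
  have "degree b > 0" using ab(3) nz(2) by (simp add: is_unit_iff_degree)
  moreover have "degree f \<le> degree a" using f nz(1) dvd_imp_degree_le by blast
  ultimately have degf: "degree f < degree Q"
    using ab(1) nz by (simp add: degree_mult_eq)
  have "f \<noteq> 0" using irr by auto
  then have degf0: "degree f > 0" using irr irreducible_not_unit is_unit_iff_degree by blast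
  have "f dvd Q" using f ab(1) by simp
  have "poly Q 0 \<noteq> 0" using g(2) by (simp add: Q_def poly_pcompose)
  then have f0: "coeff f 0 \<noteq> 0"
    using \<open>f dvd Q\<close> by (auto simp: poly_0_coeff_0 coeff_mult elim!: dvdE)
  obtain e d where ed: "f = pcompose e [:0, 0, 1:] + [:0, 1:] * pcompose d [:0, 0, 1:]"
    by (rule even_odd_decomposition)
  have refl: "reflect f = pcompose e [:0, 0, 1:] - [:0, 1:] * pcompose d [:0, 0, 1:]"
  proof -
    have "reflect f = reflect (pcompose e [:0, 0, 1:]) + reflect [:0, 1:] * reflect (pcompose d [:0, 0, 1:])"
      unfolding ed reflect_def pcompose_add pcompose_mult ..
    also have "reflect [:0, 1:] = - [:0, 1 :: 'a:]" by (simp add: reflect_def pcompose_pCons)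
    finally show ?thesis by simp
  qed
  have deg_dvd: "degree r = 0 \<or> degree r = degree g" if "r dvd g" for r
  proof -
    have "g \<noteq> 0" "r \<noteq> 0" using g(1) that by auto
    have "g dvd r \<or> is_unit r" using irreducibleD'[OF g(1) that] .
    then show ?thesis
      using \<open>g \<noteq> 0\<close> \<open>r \<noteq> 0\<close> that dvd_imp_degree_le[of g r] dvd_imp_degree_le[of r g]
      by (auto simp: is_unit_iff_degree)
  qed
  have not_dvd: "\<not> f dvd reflect f"
  proof
    assume "f dvd reflect f"
    then have "reflect f = f" using f0 by (rule dvd_reflect_imp_even)
    \<comment> \<open>Equating \<open>f\<close> with its reflection leaves twice the odd part, which
      vanishes because the characteristic is 0.\<close>
    then have "[:0, 2 :: 'a:] * pcompose d [:0, 0, 1:] = 0"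
      using refl ed by (simp add: algebra_simps)
    then have "f = pcompose e [:0, 0, 1:]" using ed by simp
    then have "e dvd g" "degree f = 2 * degree e"
      using \<open>f dvd Q\<close> pcompose_dvd_cancel[of e "[:0, 0, 1:]" g] by (simp_all add: Q_def degree_pcompose)
    with deg_dvd[of e] degf degf0 degQ show False by auto
  qed
  have "reflect Q = Q" by (simp add: Q_def)
  from even_polynomial_factor_reflect[OF irr not_dvd \<open>f dvd Q\<close> this]
  obtain m where m: "Q = f * reflect f * m" .
  \<comment> \<open>With \<open>y = x^2\<close>, this is the norm \<open>e(y)^2 - y d(y)^2\<close>
    of \<open>f = e(y) + x d(y)\<close>.\<close>
  define P where "P = e * e - [:0, 1:] * d * d"
  have P: "f * reflect f = pcompose P [:0, 0, 1:]"
  proof -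
    have "pcompose P [:0, 0, 1:] = pcompose e [:0, 0, 1:] * pcompose e [:0, 0, 1:]
        - [:0, 0, 1:] * pcompose d [:0, 0, 1:] * pcompose d [:0, 0, 1:]"
      by (simp add: P_def pcompose_diff pcompose_mult pcompose_pCons)
    also have "\<dots> = pcompose e [:0, 0, 1:] * pcompose e [:0, 0, 1:]
        - [:0, 1:] * [:0, 1:] * pcompose d [:0, 0, 1:] * pcompose d [:0, 0, 1:]"
      by simp
    also have "\<dots> = f * reflect f"
      unfolding refl unfolding ed by (simp only: algebra_simps)
    finally show ?thesis ..
  qed
  have "reflect f \<noteq> 0" using irreducible_reflect[OF irr] by auto
  then have "2 * degree f = degree (pcompose P [:0, 0, 1:])"
    using \<open>f \<noteq> 0\<close> by (simp add: degree_mult_eq flip: P)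
  then have "degree f = degree P" by (simp add: degree_pcompose)
  moreover have "pcompose P [:0, 0, 1:] dvd pcompose g [:0, 0, 1:]"
    unfolding P[symmetric] Q_def[symmetric] m by simp
  then have "P dvd g" by (rule pcompose_dvd_cancel) simp
  ultimately have deg: "degree f = degree g" using deg_dvd[of P] degf0 by auto
  have "f * reflect f dvd Q" unfolding m by simp
  moreover have "degree (f * reflect f) = degree Q"
    using deg degQ \<open>f \<noteq> 0\<close> \<open>reflect f \<noteq> 0\<close> by (simp add: degree_mult_eq)
  ultimately obtain c where "Q = smult c (f * reflect f)"
    using \<open>Q \<noteq> 0\<close> by (rule dvd_same_degreeE)
  then show ?thesis using that irr deg unfolding Q_def by blast
qed

subsection \<open>The trinomials\<close>

lemma trinomial_8_2_explicit:
  "trinomial 8 2 A B = [:B, 0, A, 0, 0, 0, 0, 0, 1:]"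
  by (simp add: trinomial_def monom_altdef numeral_eq_Suc)

lemma trinomial_4_1_explicit:
  "trinomial 4 1 A B = [:B, A, 0, 0, 1:]"
  by (simp add: trinomial_def monom_altdef numeral_eq_Suc)

lemma poly_trinomial_4_1: "poly (trinomial 4 1 A B) x = x ^ 4 + A * x + B"
  unfolding trinomial_4_1_explicit by (simp add: algebra_simps power4_eq_xxxx)

lemma trinomial_4_1_factor:
  assumes "poly (trinomial 4 1 A B) v = 0"
  shows "trinomial 4 1 A B = [:- v, 1:] * [:v ^ 3 + A, v\<^sup>2, v, 1:]"
proof -
  have "B = - v * (v ^ 3 + A)"
    using assms unfolding poly_trinomial_4_1 by algebra
  then show ?thesis
    unfolding trinomial_4_1_explicit by (simp add: power2_eq_square power3_eq_cube algebra_simps)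
qed

lemma trinomial_8_2_div:
  assumes "poly (trinomial 4 1 A B) v = 0"
  shows "trinomial 8 2 A B div (monom 1 2 - [:v:]) = [:v ^ 3 + A, 0, v\<^sup>2, 0, v, 0, 1:]"
proof -
  have B: "B = - v * (v ^ 3 + A)"
    using assms unfolding poly_trinomial_4_1 by algebra
  have m: "monom 1 2 - [:v:] = [:- v, 0, 1:]"
    by (simp add: monom_altdef numeral_eq_Suc)
  have "trinomial 8 2 A B = [:v ^ 3 + A, 0, v\<^sup>2, 0, v, 0, 1:] * (monom 1 2 - [:v:])"
    unfolding m B by (simp add: trinomial_8_2_explicit power2_eq_square power3_eq_cube)
  moreover have "monom 1 2 - [:v:] \<noteq> 0" unfolding m by simp
  ultimately show ?thesis by (metis nonzero_mult_div_cancel_right)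
qed

section \<open>The even sextic as a product of a cubic and its reflection\<close>

lemma even_sextic_pcompose: "[:w, 0, r, 0, v, 0, 1:] = pcompose [:w, r, v, 1:] [:0, 0, 1:]"
  for w r v :: "'a :: comm_semiring_1"
  by (simp add: pcompose_pCons)

lemma reflect_cubic: "reflect [:c, b, a, d:] = [:c, - b, a, - d:]"
  by (simp add: reflect_def pcompose_pCons)

lemma has_reducibility_type_if_reflect_factor:
  assumes "lead_coeff Q = 1" "irreducible f" "degree f = 3" "Q = smult c (f * reflect f)"
  shows "has_reducibility_type Q [3, 3]"
proof -
  have "c \<noteq> 0" using assms(1,4) by auto
  then have unit: "is_unit [:c:]" by (simp add: is_unit_iff_degree)
  \<comment> \<open>The unit \<open>c\<close> is absorbed into the second factor; the type asks for
    irreducible factors, not for monic ones.\<close>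
  have "irreducible ([:c:] * reflect f)"
    using irreducible_mult_unit_left[OF unit] irreducible_reflect[OF assms(2)] by blast
  then have "irreducible (smult c (reflect f))" by simp
  then have "map degree [f, smult c (reflect f)] = [3, 3] \<and>
      (\<forall>f\<in>set [f, smult c (reflect f)]. irreducible f) \<and> Q = prod_list [f, smult c (reflect f)]"
    using assms \<open>c \<noteq> 0\<close> by simp
  then show ?thesis
    unfolding has_reducibility_type_def using assms(1)
    by (intro conjI exI[of _ "[f, smult c (reflect f)]"]) auto
qed

text \<open>A cubic factor \<open>f\<close> has a non-zero coefficient at \<open>x^3\<close>, so it
  is not even. Hence \<open>f * reflect f\<close> divides \<open>Q\<close>, and both have degree
  6.\<close>

lemma reducibility_type_3_3_reflect_factor:
  assumes "has_reducibility_type Q [3, 3]" "reflect Q = Q" "coeff Q 0 \<noteq> 0"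
  obtains f c where "irreducible f" "degree f = 3" "Q = smult c (f * reflect f)"
proof -
  from assms(1) obtain fs where "map degree fs = [3, 3]" "\<forall>f\<in>set fs. irreducible f" "Q = prod_list fs"
    unfolding has_reducibility_type_def by (elim conjE exE)
  then obtain f h where fh: "irreducible f" "irreducible h" "degree f = 3" "degree h = 3" "Q = f * h"
    by (auto simp: map_eq_Cons_conv)
  have f0: "coeff f 0 \<noteq> 0" using assms(3) fh(5) by (auto simp: coeff_mult)
  have "\<not> f dvd reflect f"
  proof
    assume "f dvd reflect f"
    then have "reflect f = f" using f0 by (rule dvd_reflect_imp_even)
    from arg_cong[OF this, of "\<lambda>p. coeff p 3"] have "coeff f 3 = 0"
      by (simp add: coeff_reflect)
    then show False using fh(3) by (metis degree_0 leading_coeff_0_iff zero_neq_numeral)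
  qed
  from even_polynomial_factor_reflect[OF fh(1) this _ assms(2)] fh(5)
  obtain m where "Q = f * reflect f * m" by auto
  then have "f * reflect f dvd Q" by simp
  moreover have nz: "f \<noteq> 0" "h \<noteq> 0" using fh(1,2) by auto
  then have "degree (f * reflect f) = degree Q"
    using fh(3-5) by (simp add: degree_mult_eq)
  moreover have "Q \<noteq> 0" using nz fh(5) by simp
  ultimately obtain c where "Q = smult c (f * reflect f)" by (rule dvd_same_degreeE)
  with that fh show ?thesis by blast
qed

text \<open>The leading coefficient 1 of the sextic forces \<open>c = - 1 / (d 3)^2\<close>.
  Dividing \<open>f\<close> by \<open>d 3\<close> gives the monic cubic
  \<open>x^3 + a x^2 + b x + e\<close>, and the remaining coefficients are compared.\<close>

lemma coeffs_if_reflect_factor: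
  fixes w r v c :: rat
  assumes "degree f = 3" "[:w, 0, r, 0, v, 0, 1:] = smult c (f * reflect f)"
  obtains a b e where "v = 2 * b - a\<^sup>2" "r = b\<^sup>2 - 2 * a * e" "w = - e\<^sup>2"
proof -
  define d where "d = coeff f"
  have f: "f = [:d 0, d 1, d 2, d 3:]"
  proof (rule poly_eqI)
    fix n show "coeff f n = coeff [:d 0, d 1, d 2, d 3:] n"
      using assms(1) by (cases "n \<le> 3") (auto simp: d_def le_Suc_eq numeral_eq_Suc coeff_eq_0)
  qed
  have eq: "w = c * (d 0)\<^sup>2" "r = c * (2 * d 0 * d 2 - (d 1)\<^sup>2)"
    "v = c * ((d 2)\<^sup>2 - 2 * d 1 * d 3)" "1 = - c * (d 3)\<^sup>2"
    using assms(2) unfolding f reflect_cubic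
    by (simp_all add: power2_eq_square algebra_simps split: if_splits)
  then have "d 3 \<noteq> 0" by auto
  then have c: "c = - 1 / (d 3)\<^sup>2" using eq(4) by (simp add: field_simps)
  show ?thesis
    by (rule that[of "d 1 / d 3" "d 2 / d 3" "d 0 / d 3"])
      (use \<open>d 3 \<noteq> 0\<close> in \<open>simp_all add: eq(1-3) c field_simps power2_eq_square\<close>)
qed

text \<open>If \<open>a = 0\<close>, then \<open>v = 2 b\<close> and \<open>v^2 = b^2\<close> would
  force \<open>v = 0\<close>. So \<open>l = a\<close> and \<open>q = b / a^2\<close> are available,
  and \<open>e\<close> is determined by them. The excluded values of \<open>q\<close> are those at
  which \<open>v\<close> or \<open>w\<close> vanishes.\<close>

lemma cubic_parameters:
  fixes v w a b e :: rat
  assumes "v \<noteq> 0" "w \<noteq> 0" "v = 2 * b - a\<^sup>2" "v\<^sup>2 = b\<^sup>2 - 2 * a * e" "w = - e\<^sup>2"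
  obtains q l where "l \<noteq> 0" "q \<noteq> 1" "q \<noteq> 1 / 2" "q \<noteq> 1 / 3"
    "v = l\<^sup>2 * (2 * q - 1)" "w = - (l ^ 3 * (3 * q - 1) * (q - 1) / 2)\<^sup>2"
proof -
  have "a \<noteq> 0"
  proof
    assume "a = 0"
    then have "3 * b\<^sup>2 = 0" using assms(3,4) by (simp add: power2_eq_square)
    then show False using assms(1,3) \<open>a = 0\<close> by simp
  qed
  define q where "q = b / a\<^sup>2"
  have b: "b = q * a\<^sup>2" using \<open>a \<noteq> 0\<close> by (simp add: q_def)
  have v: "v = a\<^sup>2 * (2 * q - 1)" unfolding assms(3) b by (simp add: algebra_simps)
  \<comment> \<open>This uses \<open>(2 q - 1)^2 - q^2 = (3 q - 1) (q - 1)\<close>.\<close>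
  have "a * (2 * e + a ^ 3 * (3 * q - 1) * (q - 1)) = 0"
    using assms(4) unfolding v b by algebra
  then have "2 * e + a ^ 3 * (3 * q - 1) * (q - 1) = 0" using \<open>a \<noteq> 0\<close> by simp
  then have e: "e = - (a ^ 3 * (3 * q - 1) * (q - 1) / 2)" by algebra
  have w: "w = - (a ^ 3 * (3 * q - 1) * (q - 1) / 2)\<^sup>2" unfolding assms(5) e by simp
  have "q \<noteq> 1" "q \<noteq> 1 / 3" using w assms(2) by auto
  moreover have "q \<noteq> 1 / 2" using v assms(1) by auto
  ultimately show ?thesis using that \<open>a \<noteq> 0\<close> v w by blast
qed

lemma scaled_cubic_no_root:
  fixes q l x :: rat
  assumes "l \<noteq> 0" "q \<noteq> 1" "q \<noteq> 1 / 2" "q \<noteq> 1 / 3"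
  shows "poly [:- (l ^ 3 * (3 * q - 1) * (q - 1) / 2), q * l\<^sup>2, l, 1:] x \<noteq> 0"
proof
  assume eq: "poly [:- (l ^ 3 * (3 * q - 1) * (q - 1) / 2), q * l\<^sup>2, l, 1:] x = 0"
  define y where "y = x / l"
  have x: "x = l * y" using assms(1) by (simp add: y_def)
  have "l ^ 3 * (y ^ 3 + y\<^sup>2 + q * y - (3 * q - 1) * (q - 1) / 2) = 0"
    using eq unfolding x by (simp add: algebra_simps power2_eq_square power3_eq_cube)
  then show False using assms(1) normalized_cubic_no_root[OF assms(2-4)] by simp
qed

text \<open>With \<open>f = x^3 + a x^2 + b x + e\<close>, the hypothesis says that
  \<open>f(x) f(-x)\<close> vanishes at \<open>x^2 = v\<close>, that is,
  \<open>v (v + b)^2 = (a v + e)^2\<close>. Unless \<open>v = -b\<close>, this exhibits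
  \<open>v\<close> as the square of a rational \<open>s\<close>, chosen with the sign for which
  \<open>-s\<close> is a root of \<open>f\<close>.\<close>

lemma other_root_gives_cubic_root:
  fixes a b e u v :: rat
  assumes u: "u = 2 * b - a\<^sup>2" "u\<^sup>2 = b\<^sup>2 - 2 * a * e"
    and root: "v ^ 3 + u * v\<^sup>2 + u\<^sup>2 * v - e\<^sup>2 = 0"
  obtains x where "poly [:e, b, a, 1:] x = 0"
proof -
  have norm: "v * (v + b)\<^sup>2 = (a * v + e)\<^sup>2" using root unfolding u(2) unfolding u(1) by algebra
  show ?thesis
  proof (cases "v + b = 0")
    case True
    then have "v = - b" "a * v + e = 0" using norm by simp_all
    \<comment> \<open>At \<open>-a\<close> the cubic takes the value \<open>e - a b\<close>, which
      equals \<open>a v + e\<close>.\<close>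
    then have "poly [:e, b, a, 1:] (- a) = 0" by (simp add: algebra_simps)
    then show ?thesis by (rule that)
  next
    case False
    define s where "s = (a * v + e) / (v + b)"
    have s1: "s * (v + b) = a * v + e" using False by (simp add: s_def)
    have "s\<^sup>2 = v" using norm False by (simp add: s_def power_divide divide_eq_eq)
    then have "poly [:e, b, a, 1:] (- s) = a * v + e - s * (v + b)"
      by (simp add: algebra_simps power2_eq_square)
    then show ?thesis using s1 that[of "- s"] by simp
  qed
qed

theorem theorem6p1:
  fixes A B v :: rat and Q :: "rat poly"
  assumes "A * B \<noteq> 0"
    and "v \<noteq> 0"
    and "poly (trinomial 4 1 A B) v = 0"
  defines "Q \<equiv> trinomial 8 2 A B div (monom 1 2 - [:v:])"
  shows "(proots (trinomial 4 1 A B) = {#v#} \<longrightarrow>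
            \<not> irreducible Q \<longrightarrow> has_reducibility_type Q [3, 3]) \<and>
         (has_reducibility_type Q [3, 3] \<longleftrightarrow>
            (\<exists>q. q \<noteq> 1 \<and> q \<noteq> 1 / 2 \<and> q \<noteq> 1 / 3 \<and>
               equal_up_to_scaling (A, B)
                 (- ((q^2 + 2 * q - 1) * (9 * q^2 - 10 * q + 3) / 4),
                  (q - 1)^2 * (2 * q - 1) * (3 * q - 1)^2 / 4)))"
proof (intro conjI impI iffI)
  define w where "w = v ^ 3 + A"
  define g where "g = [:w, v\<^sup>2, v, 1:]"
  have Bw: "B = - v * w"
    using assms(3) unfolding poly_trinomial_4_1 w_def by algebra
  have Q: "Q = [:w, 0, v\<^sup>2, 0, v, 0, 1:]"
    unfolding Q_def w_def by (rule trinomial_8_2_div[OF assms(3)])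
  have Qg: "Q = pcompose g [:0, 0, 1:]"
    unfolding Q g_def by (rule even_sextic_pcompose)
  have lead: "lead_coeff Q = 1" by (simp add: Q)
  have "w \<noteq> 0" using assms(1) Bw by auto
  show "has_reducibility_type Q [3, 3]"
    if proots: "proots (trinomial 4 1 A B) = {#v#}" and red: "\<not> irreducible Q"
  proof -
    have "trinomial 4 1 A B = [:- v, 1:] * g"
      unfolding g_def w_def by (rule trinomial_4_1_factor[OF assms(3)])
    moreover have "g \<noteq> 0" by (simp add: g_def)
    then have "proots ([:- v, 1:] * g) = proots [:- v, 1:] + proots g"
      by (intro proots_mult) simp_all
    \<comment> \<open>The quartic has \<open>v\<close> as its only root, counted with multiplicity,
      which leaves none for the cofactor \<open>g\<close>.\<close>
    ultimately have "proots g = {#}" using proots by simp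
    with \<open>g \<noteq> 0\<close> have noroot: "poly g x \<noteq> 0" for x
      using set_count_proots[of g] by auto
    have deg: "degree g = 3" by (simp add: g_def)
    have irr: "irreducible g" by (rule irreducible_cubic_if_no_root[OF deg noroot])
    from reducible_even_polynomial_factorization[OF irr noroot] red
    obtain f c where f: "irreducible f" "degree f = degree g" "Q = smult c (f * reflect f)"
      unfolding Qg by blast
    show ?thesis
      by (rule has_reducibility_type_if_reflect_factor[OF lead f(1) _ f(3)]) (simp add: f(2) deg)
  qed
  show "\<exists>q. q \<noteq> 1 \<and> q \<noteq> 1 / 2 \<and> q \<noteq> 1 / 3 \<and>
      equal_up_to_scaling (A, B)
        (- ((q^2 + 2 * q - 1) * (9 * q^2 - 10 * q + 3) / 4),
         (q - 1)^2 * (2 * q - 1) * (3 * q - 1)^2 / 4)"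
    if type: "has_reducibility_type Q [3, 3]"
  proof -
    have "reflect Q = Q" by (simp add: Qg)
    moreover have "coeff Q 0 \<noteq> 0" using \<open>w \<noteq> 0\<close> by (simp add: Q)
    ultimately obtain f c where f: "irreducible f" "degree f = 3" "Q = smult c (f * reflect f)"
      using reducibility_type_3_3_reflect_factor[OF type] by blast
    obtain a b e where abe: "v = 2 * b - a\<^sup>2" "v\<^sup>2 = b\<^sup>2 - 2 * a * e" "w = - e\<^sup>2"
      using coeffs_if_reflect_factor[OF f(2) f(3)[unfolded Q]] by blast
    obtain q l where l: "l \<noteq> 0" and q: "q \<noteq> 1" "q \<noteq> 1 / 2" "q \<noteq> 1 / 3"
      and v: "v = l\<^sup>2 * (2 * q - 1)" and w: "w = - (l ^ 3 * (3 * q - 1) * (q - 1) / 2)\<^sup>2"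
      using cubic_parameters[OF assms(2) \<open>w \<noteq> 0\<close> abe] by blast
    have "A = w - v ^ 3" by (simp add: w_def)
    then have "A = - ((q^2 + 2 * q - 1) * (9 * q^2 - 10 * q + 3) / 4) * l ^ 6"
      unfolding w v by (simp add: field_simps power2_eq_square) algebra
    moreover have "B = (q - 1)^2 * (2 * q - 1) * (3 * q - 1)^2 / 4 * l ^ 8"
      unfolding Bw w v by (simp add: field_simps power2_eq_square) algebra
    ultimately show ?thesis using l q unfolding equal_up_to_scaling_def by auto
  qed
  show "has_reducibility_type Q [3, 3]"
    if "\<exists>q. q \<noteq> 1 \<and> q \<noteq> 1 / 2 \<and> q \<noteq> 1 / 3 \<and>
      equal_up_to_scaling (A, B)
        (- ((q^2 + 2 * q - 1) * (9 * q^2 - 10 * q + 3) / 4),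
         (q - 1)^2 * (2 * q - 1) * (3 * q - 1)^2 / 4)"
  proof -
    from that obtain q l where q: "q \<noteq> 1" "q \<noteq> 1 / 2" "q \<noteq> 1 / 3" and l: "l \<noteq> 0"
      and A: "A = - ((q^2 + 2 * q - 1) * (9 * q^2 - 10 * q + 3) / 4) * l ^ 6"
      and B: "B = (q - 1)^2 * (2 * q - 1) * (3 * q - 1)^2 / 4 * l ^ 8"
      unfolding equal_up_to_scaling_def by auto
    \<comment> \<open>The parametrization is read backwards: \<open>l\<close>, \<open>b\<close>,
      \<open>e\<close> are the coefficients of the cubic and \<open>u\<close> is the root it
      supplies.\<close>
    define u where "u = l\<^sup>2 * (2 * q - 1)"
    define b where "b = q * l\<^sup>2"
    define e where "e = - (l ^ 3 * (3 * q - 1) * (q - 1) / 2)"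
    define f where "f = [:e, b, l, 1:]"
    have e2: "2 * e = - (l ^ 3 * (3 * q - 1) * (q - 1))" by (simp add: e_def)
    have u: "u = 2 * b - l\<^sup>2"
      unfolding u_def b_def by algebra
    have u2: "u\<^sup>2 = b\<^sup>2 - 2 * l * e"
      using e2 unfolding u_def b_def by algebra
    \<comment> \<open>This and the next equation say that the quartic is
      \<open>(y - u) (y^3 + u y^2 + u^2 y - e^2)\<close>.\<close>
    have Au: "A = - e\<^sup>2 - u ^ 3"
      unfolding A e_def u_def by (simp add: field_simps power2_eq_square) algebra
    have Bu: "B = u * e\<^sup>2"
      unfolding B e_def u_def by (simp add: field_simps power2_eq_square) algebra
    have noroot: "poly f x \<noteq> 0" for x
      unfolding f_def e_def b_def by (rule scaled_cubic_no_root[OF l q])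
    have deg: "degree f = 3" by (simp add: f_def)
    have irr: "irreducible f" by (rule irreducible_cubic_if_no_root[OF deg noroot])
    \<comment> \<open>\<open>Q\<close> is formed with the given root \<open>v\<close>, while the
      parameter supplies \<open>u\<close>. A root \<open>v\<close> other than \<open>u\<close> would
      be a root of the cofactor and would give the root-free \<open>f\<close> a rational
      root.\<close>
    have "v = u"
    proof (rule ccontr)
      assume "v \<noteq> u"
      have "(v - u) * (v ^ 3 + u * v\<^sup>2 + u\<^sup>2 * v - e\<^sup>2) = 0"
        using assms(3) unfolding poly_trinomial_4_1 Au Bu by algebra
      then have "v ^ 3 + u * v\<^sup>2 + u\<^sup>2 * v - e\<^sup>2 = 0" using \<open>v \<noteq> u\<close> by simp
      with u u2 show False using other_root_gives_cubic_root noroot unfolding f_def by metis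
    qed
    then have "w = - e\<^sup>2" using Au by (simp add: w_def)
    have "Q = smult (- 1) (f * reflect f)"
      unfolding Q f_def reflect_cubic \<open>w = - e\<^sup>2\<close>
      using u u2 \<open>v = u\<close> by (simp add: power2_eq_square algebra_simps)
    with lead irr deg show ?thesis by (rule has_reducibility_type_if_reflect_factor)
  qed
qed

end
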